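(* For odd $n\geq3$ let $E_n$ denote the expected value of the length of a board chosen uniformly at random from the set $Sol_n$ of all solvable boards of size $n$. Then $$\lim_{n\to\infty} E_n=\frac{209}{96},$$ where the limit is taken over odd $n$.
   Context: Let $\mathcal{D}=\{\mathrm{N},\mathrm{NE},\mathrm{E},\mathrm{SE},\mathrm{S},\mathrm{SW},\mathrm{W},\mathrm{NW}\}$. For odd $n\geq 3$, a board of size $n$ is an $n\times n$ matrix $A=(a_{ij})$ with entries in $\mathcal{D}$; rows are indexed $1,\dots,n$ from top to bottom, columns from left to right. For $(i',j')\neq(i,j)$, $a_{ij}$ is directing to $(i',j')$ if: N: $j'=j$, $i'<i$; NE: $i-i'=j'-j>0$; E: $i'=i$, $j'>j$; SE: $i'-i=j'-j>0$; S: $j'=j$, $i'>i$; SW: $i'-i=j-j'>0$; W: $i'=i$, $j'<j$; NW: $i-i'=j-j'>0$. A move goes from $(i,j)$ to any position to which $a_{ij}$ is directing. $A$ is solvable if some finite sequence of moves leads from $(1,1)$ to the center $(\frac{n+1}{2},\frac{n+1}{2})$; the length of a solvable board is the minimal number of moves in such a sequence. $Sol_n$ is the (nonempty, finite) set of solvable boards of size $n$, equipped with the uniform probability measure. *)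

theory Defs
  imports "HOL-Probability.Probability"
begin

datatype dir = N | NE | E | SE | S | SW | W | NW

text \<open>A position is a pair (row, column); rows are numbered from top to bottom and columns from
  left to right, both starting at 1. Coordinates are integers so that differences do not truncate.\<close>

type_synonym pos = "int \<times> int"

definition cells :: "nat \<Rightarrow> pos set" where
  "cells n = {1..int n} \<times> {1..int n}"

text \<open>The entry \<open>a\<^sub>i\<^sub>j\<close> of a board \<open>A\<close> is \<open>A (i, j)\<close>. Boards are extensional functions
  (\<open>undefined\<close> outside the cells), so that they correspond one-to-one to the \<open>n\<close> by \<open>n\<close> matrices.\<close>

definition boards :: "nat \<Rightarrow> (pos \<Rightarrow> dir) set" where
  "boards n = (cells n \<rightarrow>\<^sub>E UNIV)"

fun directing :: "dir \<Rightarrow> pos \<Rightarrow> pos \<Rightarrow> bool" where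
  "directing N  (i, j) (i', j') \<longleftrightarrow> j' = j \<and> i' < i"
| "directing NE (i, j) (i', j') \<longleftrightarrow> i - i' = j' - j \<and> j' - j > 0"
| "directing E  (i, j) (i', j') \<longleftrightarrow> i' = i \<and> j' > j"
| "directing SE (i, j) (i', j') \<longleftrightarrow> i' - i = j' - j \<and> j' - j > 0"
| "directing S  (i, j) (i', j') \<longleftrightarrow> j' = j \<and> i' > i"
| "directing SW (i, j) (i', j') \<longleftrightarrow> i' - i = j - j' \<and> j - j' > 0"
| "directing W  (i, j) (i', j') \<longleftrightarrow> i' = i \<and> j' < j"
| "directing NW (i, j) (i', j') \<longleftrightarrow> i - i' = j - j' \<and> j - j' > 0"

definition moves :: "nat \<Rightarrow> (pos \<Rightarrow> dir) \<Rightarrow> (pos \<times> pos) set" where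
  "moves n A = {(p, q). p \<in> cells n \<and> q \<in> cells n \<and> directing (A p) p q}"

definition center :: "nat \<Rightarrow> pos" where
  "center n = ((int n + 1) div 2, (int n + 1) div 2)"

definition solvable :: "nat \<Rightarrow> (pos \<Rightarrow> dir) \<Rightarrow> bool" where
  "solvable n A \<longleftrightarrow> (\<exists>k. ((1, 1), center n) \<in> moves n A ^^ k)"

definition board_length :: "nat \<Rightarrow> (pos \<Rightarrow> dir) \<Rightarrow> nat" where
  "board_length n A = (LEAST k. ((1, 1), center n) \<in> moves n A ^^ k)"

definition Sol :: "nat \<Rightarrow> (pos \<Rightarrow> dir) set" where
  "Sol n = {A \<in> boards n. solvable n A}"

text \<open>\<open>pmf_of_set\<close> is the uniform distribution only on a finite nonempty set.\<close>

lemma finite_Sol: "finite (Sol n)"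
proof -
  have "(UNIV :: dir set) = {N, NE, E, SE, S, SW, W, NW}"
    using dir.exhaust by blast
  then have "finite (UNIV :: dir set)"
    by (metis finite.emptyI finite.insertI)
  then have "finite (boards n)"
    by (auto simp: boards_def cells_def intro!: finite_PiE)
  then show ?thesis
    by (simp add: Sol_def)
qed

lemma Sol_nonempty:
  assumes "n \<ge> 3"
  shows "Sol n \<noteq> {}"
proof -
  let ?A = "restrict (\<lambda>_. SE) (cells n)"
  have "(1, 1) \<in> cells n" "center n \<in> cells n"
    using assms by (auto simp: cells_def center_def)
  moreover from this have "directing (?A (1, 1)) (1, 1) (center n)"
    using assms by (simp add: center_def)
  ultimately have "((1, 1), center n) \<in> moves n ?A ^^ 1"
    by (simp add: moves_def)
  then have "solvable n ?A"
    unfolding solvable_def by blast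
  then have "?A \<in> Sol n"
    by (simp add: Sol_def boards_def)
  then show ?thesis by blast
qed

definition expected_length :: "nat \<Rightarrow> real" where
  "expected_length n = measure_pmf.expectation (pmf_of_set (Sol n)) (\<lambda>A. real (board_length n A))"

end

theory Submission
  imports Defs "HOL-Real_Asymp.Real_Asymp"
begin

text \<open>A solvable board has \<open>SE\<close>, \<open>E\<close> or \<open>S\<close> in its corner. With \<open>SE\<close> the length is 1. With \<open>E\<close>,
  the only cells of the first row that can point at the center are the middle one (by \<open>S\<close>) and the
  last one (by \<open>SW\<close>), so length 2 has conditional probability \<open>1 - (7/8)\<^sup>2 = 15/64\<close>. Otherwise the
  length is 3 unless all the paths through a first-row cell and the middle row fail; already those
  in the left half are about \<open>n/2\<close> independent chances, so this has probability exponentially small in \<open>n\<close>, which beats the polynomial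
  bound on the length. The case \<open>S\<close> is the transpose of the case \<open>E\<close>. Hence the limit is
  \<open>(1 + 2 (2 \<cdot> 15/64 + 3 \<cdot> 49/64)) / 3 = 209/96\<close>.\<close>

subsection \<open>Independence of the entries\<close>

lemma UNIV_dir: "(UNIV :: dir set) = {N, NE, E, SE, S, SW, W, NW}"
  using dir.exhaust by blast

lemma card_dir: "card (UNIV :: dir set) = 8"
  by (simp add: UNIV_dir)

lemma finite_cells: "finite (cells n)"
  by (simp add: cells_def)

lemma finite_boards: "finite (boards n)"
  unfolding boards_def
  by (intro finite_PiE finite_cells) (simp add: UNIV_dir)

lemma boards_nonempty: "boards n \<noteq> {}"
  by (simp add: boards_def PiE_eq_empty_iff)

lemma card_boards_pos: "card (boards n) > 0"
  by (simp add: card_gt_0_iff finite_boards boards_nonempty)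

text \<open>Uniform probability over all boards, not only the solvable ones: there the entries are
  independent. Conditioning on \<open>Sol n\<close> is postponed to a quotient at the end.\<close>

definition board_prob :: "nat \<Rightarrow> ((pos \<Rightarrow> dir) \<Rightarrow> bool) \<Rightarrow> real" where
  "board_prob n P = real (card {A \<in> boards n. P A}) / real (card (boards n))"

lemma board_prob_True: "board_prob n (\<lambda>_. True) = 1"
  using card_boards_pos[of n] by (simp add: board_prob_def)

lemma board_prob_split:
  "board_prob n (\<lambda>A. P A \<and> Q A) + board_prob n (\<lambda>A. P A \<and> \<not> Q A) = board_prob n P"
proof -
  have "card {A \<in> boards n. P A} =
      card ({A \<in> boards n. P A \<and> Q A} \<union> {A \<in> boards n. P A \<and> \<not> Q A})"
    by (rule arg_cong[where f = card]) blast
  also have "\<dots> = card {A \<in> boards n. P A \<and> Q A} + card {A \<in> boards n. P A \<and> \<not> Q A}"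
    by (rule card_Un_disjoint) (auto simp: finite_boards)
  finally have "card {A \<in> boards n. P A} =
      card {A \<in> boards n. P A \<and> Q A} + card {A \<in> boards n. P A \<and> \<not> Q A}" .
  then show ?thesis
    by (simp add: board_prob_def add_divide_distrib)
qed

lemma board_prob_not: "board_prob n (\<lambda>A. \<not> P A) = 1 - board_prob n P"
  using board_prob_split[of n "\<lambda>_. True" P] by (simp add: board_prob_True)

text \<open>Swapping the entries in \<open>C\<close> between two boards is an involution on pairs of boards.\<close>

lemma board_prob_indep:
  assumes Q: "\<And>A B. (\<And>p. p \<notin> C \<Longrightarrow> A p = B p) \<Longrightarrow> Q A = Q B"
    and R: "\<And>A B. (\<And>p. p \<in> C \<Longrightarrow> A p = B p) \<Longrightarrow> R A = R B"
  shows "board_prob n (\<lambda>A. Q A \<and> R A) = board_prob n Q * board_prob n R"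
proof -
  let ?f = "\<lambda>(A, B). (override_on A B C, override_on B A C)"
  have ov: "override_on A B C \<in> boards n" if "A \<in> boards n" "B \<in> boards n" for A B
    using that by (auto simp: boards_def PiE_iff extensional_def override_on_def)
  have Qov: "Q (override_on A B C) = Q A" for A B
    by (rule Q) simp
  have Rov: "R (override_on A B C) = R B" for A B
    by (rule R) simp
  have inv: "override_on (override_on A B C) (override_on B A C) C = A" for A B :: "pos \<Rightarrow> dir"
    by (auto simp: override_on_def)
  \<comment> \<open>If \<open>A\<close> satisfies both properties and \<open>B\<close> is arbitrary,
    then after the swap the first component inherits \<open>Q\<close> from \<open>A\<close> and the
    second inherits \<open>R\<close> from \<open>A\<close>.\<close>
  have "bij_betw ?f ({A \<in> boards n. Q A \<and> R A} \<times> boards n)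
      ({A \<in> boards n. Q A} \<times> {A \<in> boards n. R A})"
    by (rule bij_betw_byWitness[where f' = ?f]) (auto simp: ov Qov Rov inv)
  then have "card {A \<in> boards n. Q A \<and> R A} * card (boards n) =
      card {A \<in> boards n. Q A} * card {A \<in> boards n. R A}"
    using bij_betw_same_card by (fastforce simp: card_cartesian_product)
  then have "real (card {A \<in> boards n. Q A \<and> R A}) * real (card (boards n)) =
      real (card {A \<in> boards n. Q A}) * real (card {A \<in> boards n. R A})"
    by (simp flip: of_nat_mult)
  then show ?thesis
    using card_boards_pos[of n] by (simp add: board_prob_def field_simps)
qed

lemma board_prob_entry:
  assumes "p \<in> cells n"
  shows "board_prob n (\<lambda>A. A p = d) = 1 / 8"
proof -
  \<comment> \<open>Fixing one entry leaves a product set again, with one factor 8 replaced by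
    1.\<close>
  have "{A \<in> boards n. A p = d} = (\<Pi>\<^sub>E q\<in>cells n. if q = p then {d} else UNIV)"
    using assms by (auto simp: boards_def PiE_iff extensional_def split: if_splits)
  then have 1: "card {A \<in> boards n. A p = d} =
      (\<Prod>q\<in>cells n. card (if q = p then {d} else (UNIV :: dir set)))"
    by (simp add: card_PiE finite_cells)
  have "\<dots> = (\<Prod>q\<in>cells n - {p}. 8)"
    unfolding prod.remove[OF finite_cells assms] by (simp add: card_dir)
  moreover have "card (boards n) = (\<Prod>q\<in>cells n. 8)"
    unfolding boards_def by (simp add: card_PiE finite_cells card_dir)
  then have "card (boards n) = 8 * (\<Prod>q\<in>cells n - {p}. 8)"
    unfolding prod.remove[OF finite_cells assms] .
  ultimately show ?thesis
    using 1 by (simp add: board_prob_def)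
qed

lemma board_prob_two_entries:
  assumes "p \<in> cells n" "q \<in> cells n" "p \<noteq> q"
  shows "board_prob n (\<lambda>A. A p = d \<and> A q = e) = 1 / 64"
proof -
  have "board_prob n (\<lambda>A. A p = d \<and> A q = e) = board_prob n (\<lambda>A. A p = d) * board_prob n (\<lambda>A. A q = e)"
    by (rule board_prob_indep[where C = "{q}"]) (use assms in auto)
  then show ?thesis
    using assms by (simp add: board_prob_entry)
qed

text \<open>The pairs of cells \<open>{a j, b j}\<close> are pairwise disjoint, so the events are
  independent, and each fails to occur with probability \<open>1 - 1/64\<close>.\<close>

lemma board_prob_no_pair:
  assumes "finite J" "inj_on a J" "inj_on b J" "a ` J \<inter> b ` J = {}"
    "a ` J \<subseteq> cells n" "b ` J \<subseteq> cells n"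
  shows "board_prob n (\<lambda>A. \<forall>j\<in>J. \<not> (A (a j) = d \<and> A (b j) = e)) = (63 / 64) ^ card J"
  using assms
proof (induction J rule: finite_induct)
  case empty
  then show ?case by (simp add: board_prob_True)
next
  case (insert k J)
  have "board_prob n (\<lambda>A. \<forall>j\<in>insert k J. \<not> (A (a j) = d \<and> A (b j) = e)) =
      board_prob n (\<lambda>A. (\<forall>j\<in>J. \<not> (A (a j) = d \<and> A (b j) = e)) \<and> \<not> (A (a k) = d \<and> A (b k) = e))"
    by (rule arg_cong[where f = "board_prob n"]) auto
  also have "\<dots> = board_prob n (\<lambda>A. \<forall>j\<in>J. \<not> (A (a j) = d \<and> A (b j) = e)) *
      board_prob n (\<lambda>A. \<not> (A (a k) = d \<and> A (b k) = e))"
  \<comment> \<open>Split off the two cells of \<open>k\<close>: injectivity and the disjoint images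
    keep every other pair away from them.\<close>
  proof (rule board_prob_indep[where C = "{a k, b k}"], goal_cases)
    case (1 A B)
    have "A (a j) = B (a j)" "A (b j) = B (b j)" if "j \<in> J" for j
    proof -
      have "a j \<noteq> a k" "b j \<noteq> b k"
        using that insert.prems(1,2) insert.hyps(2) by (metis inj_onD insertCI)+
      moreover have "a j \<noteq> b k" "b j \<noteq> a k"
        using that insert.prems(3) by blast+
      ultimately show "A (a j) = B (a j)" "A (b j) = B (b j)"
        by (simp_all add: 1)
    qed
    then show ?case by simp
  next
    case (2 A B)
    then show ?case by auto
  qed
  also have "board_prob n (\<lambda>A. \<forall>j\<in>J. \<not> (A (a j) = d \<and> A (b j) = e)) = (63 / 64) ^ card J"
  proof (rule insert.IH)
    show "inj_on a J" "inj_on b J"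
      using insert.prems(1,2) by (simp_all add: inj_on_insert)
  qed (use insert.prems(3-5) in blast)+
  also have "board_prob n (\<lambda>A. \<not> (A (a k) = d \<and> A (b k) = e)) = 63 / 64"
  proof -
    have "a k \<in> cells n" "b k \<in> cells n" "a k \<noteq> b k"
      using insert.prems(3-5) by blast+
    then show ?thesis
      unfolding board_prob_not by (simp add: board_prob_two_entries)
  qed
  finally show ?case
    using insert.hyps by simp
qed

subsection \<open>Short paths\<close>

lemma center_odd: "center (Suc (2 * h)) = (int h + 1, int h + 1)"
  by (simp add: center_def)

text \<open>A shortest path needs no more steps than there are moves, hence at most the number of
  pairs of cells. This crude bound suffices, since it is only used against an exponentially small
  probability.\<close>

lemma board_length_le:
  assumes "A \<in> Sol n"
  shows "board_length n A \<le> n ^ 4"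
proof -
  have sub: "moves n A \<subseteq> cells n \<times> cells n"
    by (auto simp: moves_def)
  then have fin: "finite (moves n A)"
    using finite_cells finite_subset by blast
  have "card (moves n A) \<le> card (cells n \<times> cells n)"
    using sub by (intro card_mono) (simp_all add: finite_cells)
  also have "\<dots> = n ^ 4"
    by (simp add: cells_def card_cartesian_product power4_eq_xxxx)
  finally have le: "card (moves n A) \<le> n ^ 4" .
  obtain k where "((1, 1), center n) \<in> moves n A ^^ k"
    using assms by (auto simp: Sol_def solvable_def)
  then obtain l where l: "((1, 1), center n) \<in> moves n A ^^ l" "l \<le> card (moves n A)"
    using relpow_finite_bounded[OF fin, of k] by blast
  then have "board_length n A \<le> l"
    unfolding board_length_def by (intro Least_le)
  with l le show ?thesis by simp
qed

lemma board_length_eqI: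
  assumes "((1, 1), center n) \<in> moves n A ^^ k"
    and "\<And>l. l < k \<Longrightarrow> ((1, 1), center n) \<notin> moves n A ^^ l"
  shows "board_length n A = k"
  unfolding board_length_def
  by (rule Least_equality) (use assms not_le in blast)+

text \<open>The other five directions leave the board from the corner, and the center is not the
  corner, so a first move must exist.\<close>

lemma corner_dirs:
  assumes "A \<in> Sol n" "n \<ge> 3"
  shows "A (1, 1) \<in> {SE, E, S}"
proof -
  obtain k where k: "((1, 1), center n) \<in> moves n A ^^ k"
    using assms by (auto simp: Sol_def solvable_def)
  have "center n \<noteq> (1, 1)"
    using assms(2) by (simp add: center_def)
  then have "k \<noteq> 0"
    using k by (metis IdE pair_in_Id_conv relpow.simps(1))
  then obtain q where "((1, 1), q) \<in> moves n A"
    using k by (metis not0_implies_Suc relpow_Suc_D2)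
  then show ?thesis
    by (cases "A (1, 1)"; cases q) (auto simp: moves_def cells_def)
qed

lemma corner_SE:
  assumes "A \<in> boards n" "odd n" "n > 1" "A (1, 1) = SE"
  shows "A \<in> Sol n" "board_length n A = 1"
proof -
  obtain h where n: "n = 2 * h + 1" using assms(2) by (rule oddE)
  have "((1, 1), center n) \<in> moves n A"
    using assms(3,4) by (simp add: n center_odd moves_def cells_def)
  then have 1: "((1, 1), center n) \<in> moves n A ^^ 1"
    by simp
  then show "A \<in> Sol n"
    using assms(1) unfolding Sol_def solvable_def by blast
  show "board_length n A = 1"
    by (rule board_length_eqI[OF 1]) (use assms(3) in \<open>auto simp: n center_odd\<close>)
qed

definition second_move_wins :: "nat \<Rightarrow> (pos \<Rightarrow> dir) \<Rightarrow> bool" where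
  "second_move_wins h A \<longleftrightarrow> A (1, int h + 1) = S \<or> A (1, 2 * int h + 1) = SW"

text \<open>A column violating this gives the path corner, \<open>(1, j)\<close>,
  \<open>(h + 1, j)\<close>, center. The range of \<open>j\<close> stays strictly between the corner
  column and the middle column, so that \<open>E\<close> points at the center.\<close>

definition no_crossing :: "nat \<Rightarrow> (pos \<Rightarrow> dir) \<Rightarrow> bool" where
  "no_crossing h A \<longleftrightarrow> (\<forall>j\<in>{2..int h}. \<not> (A (1, j) = S \<and> A (int h + 1, j) = E))"

lemma two_moves_iff:
  assumes "h > 0" "n = 2 * h + 1" "A (1, 1) = E"
  shows "((1, 1), center n) \<in> moves n A ^^ 2 \<longleftrightarrow> second_move_wins h A"
proof
  assume "((1, 1), center n) \<in> moves n A ^^ 2"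
  then obtain q where q: "((1, 1), q) \<in> moves n A" "(q, center n) \<in> moves n A"
    by (auto simp: numeral_2_eq_2)
  obtain i j where ij: "q = (i, j)" by (cases q)
  have "i = 1" "j > 1"
    using q(1) assms(3) by (auto simp: ij moves_def)
  moreover have "directing (A (i, j)) (i, j) (int h + 1, int h + 1)"
    using q(2) by (simp add: ij moves_def assms(2) center_odd)
  ultimately show "second_move_wins h A"
    \<comment> \<open>From the first row only \<open>SE\<close>, \<open>S\<close> and
      \<open>SW\<close> can reach the center, from columns 1, \<open>h + 1\<close> and
      \<open>2 * h + 1\<close> respectively; \<open>j > 1\<close> rules out
      \<open>SE\<close>.\<close>
    using assms(1) by (cases "A (i, j)") (auto simp: second_move_wins_def algebra_simps)
next
  assume w: "second_move_wins h A"
  have "\<exists>q. ((1, 1), q) \<in> moves n A \<and> (q, center n) \<in> moves n A"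
  proof (cases "A (1, int h + 1) = S")
    case True
    then show ?thesis
      using assms by (intro exI[of _ "(1, int h + 1)"]) (auto simp: moves_def center_odd cells_def)
  next
    case False
    then have "A (1, 2 * int h + 1) = SW"
      using w by (simp add: second_move_wins_def)
    then show ?thesis
      using assms
      by (intro exI[of _ "(1, 2 * int h + 1)"]) (auto simp: moves_def center_odd cells_def)
  qed
  then show "((1, 1), center n) \<in> moves n A ^^ 2"
    by (auto simp: numeral_2_eq_2)
qed

text \<open>A crossing column gives a path of three moves. Zero or one move cannot suffice, as the
  center is not in the first row, so only the test for two moves remains.\<close>

lemma corner_E:
  assumes "A \<in> boards n" "h > 0" "n = 2 * h + 1" "A (1, 1) = E" "\<not> no_crossing h A"
  shows "A \<in> Sol n" "board_length n A = (if second_move_wins h A then 2 else 3)"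
proof -
  have 0: "((1, 1), center n) \<notin> moves n A ^^ 0"
    using assms(2,3) by (simp add: center_odd)
  have 1: "((1, 1), center n) \<notin> moves n A ^^ 1"
    using assms(2-4) by (auto simp: center_odd moves_def)
  obtain j where j: "2 \<le> j" "j \<le> int h" "A (1, j) = S" "A (int h + 1, j) = E"
    using assms(5) by (auto simp: no_crossing_def)
  have "((1, 1), (1, j)) \<in> moves n A" "((1, j), (int h + 1, j)) \<in> moves n A"
    "((int h + 1, j), center n) \<in> moves n A"
    using assms j by (auto simp: moves_def cells_def center_odd)
  then have 3: "((1, 1), center n) \<in> moves n A ^^ 3"
    by (auto simp: numeral_3_eq_3)
  then show "A \<in> Sol n"
    using assms(1) unfolding Sol_def solvable_def by blast
  have two: "((1, 1), center n) \<in> moves n A ^^ 2 \<longleftrightarrow> second_move_wins h A"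
    using assms(2-4) by (rule two_moves_iff)
  show "board_length n A = (if second_move_wins h A then 2 else 3)"
  proof (cases "second_move_wins h A")
    case True
    have "board_length n A = 2"
    proof (rule board_length_eqI)
      show "((1, 1), center n) \<notin> moves n A ^^ l" if "l < 2" for l
        using that 0 1 by (auto simp: less_2_cases_iff)
    qed (use True two in simp)
    then show ?thesis using True by simp
  next
    case False
    have "board_length n A = 3"
    proof (rule board_length_eqI[OF 3])
      fix l :: nat assume "l < 3"
      then have "l = 0 \<or> l = 1 \<or> l = 2" by auto
      then show "((1, 1), center n) \<notin> moves n A ^^ l"
        using 0 1 two False by metis
    qed
    then show ?thesis using False by simp
  qed
qed

subsection \<open>Transposition\<close>

fun transpose_dir :: "dir \<Rightarrow> dir" where
  "transpose_dir N = W"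
| "transpose_dir NE = SW"
| "transpose_dir E = S"
| "transpose_dir SE = SE"
| "transpose_dir S = E"
| "transpose_dir SW = NE"
| "transpose_dir W = N"
| "transpose_dir NW = NW"

text \<open>Reflection in the main diagonal, restricted to the cells so that the result is again
  extensional.\<close>

definition transpose_board :: "nat \<Rightarrow> (pos \<Rightarrow> dir) \<Rightarrow> pos \<Rightarrow> dir" where
  "transpose_board n A = (\<lambda>p\<in>cells n. transpose_dir (A (prod.swap p)))"

lemma transpose_dir_twice: "transpose_dir (transpose_dir d) = d"
  by (cases d) auto

lemma swap_in_cells: "prod.swap p \<in> cells n \<longleftrightarrow> p \<in> cells n"
  by (cases p) (auto simp: cells_def)

lemma transpose_board_twice:
  assumes "A \<in> boards n"
  shows "transpose_board n (transpose_board n A) = A"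
proof
  fix p
  show "transpose_board n (transpose_board n A) p = A p"
    using assms
    by (cases "p \<in> cells n")
      (auto simp: transpose_board_def swap_in_cells transpose_dir_twice boards_def)
qed

lemma transpose_board_in_boards: "transpose_board n A \<in> boards n"
  by (auto simp: transpose_board_def boards_def)

lemma directing_transpose:
  "directing (transpose_dir d) p q \<longleftrightarrow> directing d (prod.swap p) (prod.swap q)"
  by (cases d; cases p; cases q) auto

lemma moves_transpose:
  "(p, q) \<in> moves n (transpose_board n A) \<longleftrightarrow> (prod.swap p, prod.swap q) \<in> moves n A"
  by (auto simp: moves_def swap_in_cells directing_transpose transpose_board_def)

lemma moves_transpose_relpow:
  "(p, q) \<in> moves n (transpose_board n A) ^^ k \<longleftrightarrow>
    (prod.swap p, prod.swap q) \<in> moves n A ^^ k"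
proof (induction k arbitrary: q)
  case 0
  then show ?case by (cases p; cases q) auto
next
  case (Suc k)
  have "(p, q) \<in> moves n (transpose_board n A) ^^ Suc k \<longleftrightarrow>
      (\<exists>r. (prod.swap p, prod.swap r) \<in> moves n A ^^ k \<and> (prod.swap r, prod.swap q) \<in> moves n A)"
    by (simp add: relcomp_unfold Suc.IH moves_transpose)
  \<comment> \<open>Swapping is an involution, so the intermediate position may be renamed.\<close>
  also have "\<dots> \<longleftrightarrow>
      (\<exists>r. (prod.swap p, r) \<in> moves n A ^^ k \<and> (r, prod.swap q) \<in> moves n A)"
    by (metis swap_swap)
  finally show ?case
    by (simp add: relcomp_unfold)
qed

text \<open>Corner and center both lie on the main diagonal and are fixed by the reflection.\<close>

lemma path_transpose:
  "((1, 1), center n) \<in> moves n (transpose_board n A) ^^ k \<longleftrightarrow>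
    ((1, 1), center n) \<in> moves n A ^^ k"
  unfolding moves_transpose_relpow by (simp add: center_def)

lemma board_length_transpose: "board_length n (transpose_board n A) = board_length n A"
  by (simp add: board_length_def path_transpose)

lemma Sol_transpose: "A \<in> Sol n \<Longrightarrow> transpose_board n A \<in> Sol n"
  by (simp add: Sol_def solvable_def path_transpose transpose_board_in_boards)

lemma bij_betw_transpose:
  assumes "n > 0"
  shows "bij_betw (transpose_board n) {A \<in> Sol n. A (1, 1) = E} {A \<in> Sol n. A (1, 1) = S}"
proof (rule bij_betw_byWitness[where f' = "transpose_board n"])
  have "transpose_board n A (1, 1) = transpose_dir (A (1, 1))" for A
    using assms by (simp add: transpose_board_def cells_def)
  then show "transpose_board n ` {A \<in> Sol n. A (1, 1) = E} \<subseteq> {A \<in> Sol n. A (1, 1) = S}"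
    "transpose_board n ` {A \<in> Sol n. A (1, 1) = S} \<subseteq> {A \<in> Sol n. A (1, 1) = E}"
    by (auto simp: Sol_transpose)
qed (auto simp: Sol_def transpose_board_twice)

text \<open>Split by the corner entry: all boards with \<open>SE\<close> are solvable with length 1
  and make up one eighth of all boards; the \<open>S\<close> part equals the \<open>E\<close> part
  by transposition.\<close>

lemma sum_Sol:
  fixes F :: "nat \<Rightarrow> real"
  assumes "odd n" "n \<ge> 3"
  shows "(\<Sum>A\<in>Sol n. F (board_length n A)) / card (boards n) =
    F 1 / 8 + 2 * ((\<Sum>A\<in>{A \<in> Sol n. A (1, 1) = E}. F (board_length n A)) / card (boards n))"
proof -
  let ?X = "\<lambda>d. {A \<in> Sol n. A (1, 1) = d}"
  have Sol_eq: "Sol n = {A \<in> boards n. A (1, 1) = SE} \<union> (?X E \<union> ?X S)"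
    using corner_dirs[of _ n] corner_SE(1)[of _ n] assms by (auto simp: Sol_def)
  have "(\<Sum>A\<in>Sol n. F (board_length n A)) =
      (\<Sum>A\<in>{A \<in> boards n. A (1, 1) = SE}. F (board_length n A)) +
      (\<Sum>A\<in>?X E \<union> ?X S. F (board_length n A))"
    by (subst Sol_eq, rule sum.union_disjoint) (auto simp: finite_boards finite_Sol)
  also have "(\<Sum>A\<in>?X E \<union> ?X S. F (board_length n A)) =
      (\<Sum>A\<in>?X E. F (board_length n A)) + (\<Sum>A\<in>?X S. F (board_length n A))"
    by (rule sum.union_disjoint) (auto simp: finite_Sol)
  also have "(\<Sum>A\<in>?X S. F (board_length n A)) = (\<Sum>A\<in>?X E. F (board_length n A))"
    using assms
    by (subst sum.reindex_bij_betw[OF bij_betw_transpose, symmetric])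
      (simp_all add: board_length_transpose)
  also have "(\<Sum>A\<in>{A \<in> boards n. A (1, 1) = SE}. F (board_length n A)) =
      (\<Sum>A\<in>{A \<in> boards n. A (1, 1) = SE}. F 1)"
    using assms by (intro sum.cong refl) (simp add: corner_SE)
  also have "\<dots> = card (boards n) * (F 1 / 8)"
    using board_prob_entry[of "(1, 1)" n SE] card_boards_pos[of n] assms
    by (simp add: board_prob_def cells_def field_simps)
  finally show ?thesis
    using card_boards_pos[of n] by (simp add: add_divide_distrib)
qed

subsection \<open>The boards starting with a move to the east\<close>

text \<open>Three distinct cells are involved, giving \<open>1/8 * (7/8)^2\<close>.\<close>

lemma board_prob_no_second_move:
  assumes "h > 0" "n = 2 * h + 1"
  shows "board_prob n (\<lambda>A. A (1, 1) = E \<and> \<not> second_move_wins h A) = 49 / 512"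
proof -
  have cells: "(1, 1) \<in> cells n" "(1, int h + 1) \<in> cells n" "(1, 2 * int h + 1) \<in> cells n"
    using assms by (auto simp: cells_def)
  have "board_prob n (\<lambda>A. A (1, 1) = E \<and> \<not> second_move_wins h A) =
      board_prob n (\<lambda>A. (A (1, 1) = E \<and> A (1, int h + 1) \<noteq> S) \<and> A (1, 2 * int h + 1) \<noteq> SW)"
    by (simp add: second_move_wins_def)
  also have "\<dots> = board_prob n (\<lambda>A. A (1, 1) = E \<and> A (1, int h + 1) \<noteq> S) *
      board_prob n (\<lambda>A. A (1, 2 * int h + 1) \<noteq> SW)"
    by (rule board_prob_indep[where C = "{(1, 2 * int h + 1)}"]) (use assms in auto)
  also have "board_prob n (\<lambda>A. A (1, 1) = E \<and> A (1, int h + 1) \<noteq> S) =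
      board_prob n (\<lambda>A. A (1, 1) = E) * board_prob n (\<lambda>A. A (1, int h + 1) \<noteq> S)"
    by (rule board_prob_indep[where C = "{(1, int h + 1)}"]) (use assms in auto)
  finally show ?thesis
    by (simp add: board_prob_not board_prob_entry cells)
qed

text \<open>There are \<open>h - 1\<close> columns to try, and their cells in the first and the
  middle row are all distinct.\<close>

lemma board_prob_no_crossing:
  assumes "h > 0" "n = 2 * h + 1"
  shows "board_prob n (no_crossing h) = (63 / 64) ^ (h - 1)"
proof -
  have "board_prob n (\<lambda>A. \<forall>j\<in>{2..int h}. \<not> (A (1, j) = S \<and> A (int h + 1, j) = E)) =
      (63 / 64) ^ card {2..int h}"
    using assms by (intro board_prob_no_pair) (auto simp: cells_def inj_on_def)
  moreover have "card {2..int h} = h - 1"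
    by simp
  ultimately show ?thesis
    unfolding no_crossing_def[abs_def] by simp
qed

text \<open>Taking \<open>F\<close> to be the identity and the constant 1 covers the numerator and the denominator
  of the expected length at once.\<close>

lemma sum_corner_E_approx:
  fixes F :: "nat \<Rightarrow> real"
  assumes "h > 0" "n = 2 * h + 1" and F: "\<And>k. k \<le> n ^ 4 \<Longrightarrow> \<bar>F k\<bar> \<le> real (n ^ 4)"
  shows "\<bar>(\<Sum>A\<in>{A \<in> Sol n. A (1, 1) = E}. F (board_length n A)) / card (boards n)
      - (15 * F 2 + 49 * F 3) / 512\<bar> \<le> 2 * real (n ^ 4) * (63 / 64) ^ (h - 1)"
proof -
  let ?B = "{A \<in> boards n. A (1, 1) = E}"
  \<comment> \<open>\<open>f\<close> is the true value, set to 0 on unsolvable boards so that it can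
    be compared with the predicted value \<open>g\<close> on all of \<open>?B\<close>.\<close>
  define f where "f A = (if A \<in> Sol n then F (board_length n A) else 0)" for A
  define g where "g A = (if second_move_wins h A then F 2 else F 3)" for A
  have n3: "3 \<le> n"
    using assms by simp
  \<comment> \<open>This brings the arguments 2 and 3 into the range where \<open>F\<close> is
    bounded.\<close>
  have n4: "3 \<le> n ^ 4"
    using n3 self_le_power[of n 4] by simp
  have finB: "finite ?B"
    by (simp add: finite_boards)
  have sumf: "(\<Sum>A\<in>{A \<in> Sol n. A (1, 1) = E}. F (board_length n A)) = sum f ?B"
    unfolding f_def
    by (rule sum.mono_neutral_cong_left) (auto simp: finite_boards Sol_def)
  have "?B \<inter> {A. second_move_wins h A} = {A \<in> boards n. A (1, 1) = E \<and> second_move_wins h A}"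
    "?B \<inter> - {A. second_move_wins h A} = {A \<in> boards n. A (1, 1) = E \<and> \<not> second_move_wins h A}"
    by auto
  then have "sum g ?B / card (boards n) =
      board_prob n (\<lambda>A. A (1, 1) = E \<and> second_move_wins h A) * F 2 +
      board_prob n (\<lambda>A. A (1, 1) = E \<and> \<not> second_move_wins h A) * F 3"
    unfolding g_def by (simp add: sum.If_cases finB board_prob_def add_divide_distrib)
  \<comment> \<open>The complement within the corner event: \<open>1/8 - 49/512\<close>.\<close>
  moreover have "board_prob n (\<lambda>A. A (1, 1) = E \<and> second_move_wins h A) = 15 / 512"
    using board_prob_split[of n "\<lambda>A. A (1, 1) = E" "second_move_wins h"]
      board_prob_no_second_move[OF assms(1,2)] assms(1,2)
    by (simp add: board_prob_entry cells_def)
  ultimately have sumg: "sum g ?B / card (boards n) = (15 * F 2 + 49 * F 3) / 512"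
    using board_prob_no_second_move[OF assms(1,2)] by simp
  \<comment> \<open>Where a crossing column exists, \<open>f\<close> and \<open>g\<close> agree;
    elsewhere each is at most \<open>n ^ 4\<close> in absolute value.\<close>
  have diff: "\<bar>f A - g A\<bar> \<le> (if no_crossing h A then 2 * real (n ^ 4) else 0)"
    if "A \<in> ?B" for A
  proof (cases "no_crossing h A")
    case True
    have "\<bar>f A\<bar> \<le> real (n ^ 4)"
      using F board_length_le[of A n] by (auto simp: f_def)
    moreover have "\<bar>g A\<bar> \<le> real (n ^ 4)"
      using F n4 by (auto simp: g_def)
    ultimately show ?thesis using True by simp
  next
    case False
    then show ?thesis
      using that corner_E[of A n h] assms(1,2) by (simp add: f_def g_def)
  qed
  have "\<bar>sum f ?B - sum g ?B\<bar> \<le> (\<Sum>A\<in>?B. \<bar>f A - g A\<bar>)"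
    unfolding sum_subtractf[symmetric] by (rule sum_abs)
  also have "\<dots> \<le> (\<Sum>A\<in>?B. if no_crossing h A then 2 * real (n ^ 4) else 0)"
    by (intro sum_mono diff)
  \<comment> \<open>Dropping the corner condition only adds nonnegative terms and leaves exactly the
    probability of \<open>no_crossing\<close>.\<close>
  also have "\<dots> \<le> (\<Sum>A\<in>boards n. if no_crossing h A then 2 * real (n ^ 4) else 0)"
    by (intro sum_mono2) (auto simp: finite_boards)
  also have "\<dots> = 2 * real (n ^ 4) * card {A \<in> boards n. no_crossing h A}"
    by (simp add: sum.If_cases finite_boards Int_def)
  finally have "\<bar>sum f ?B - sum g ?B\<bar> / card (boards n) \<le> 2 * real (n ^ 4) * board_prob n (no_crossing h)"
    using card_boards_pos[of n] by (simp add: board_prob_def divide_right_mono)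
  moreover have "\<bar>sum f ?B / card (boards n) - sum g ?B / card (boards n)\<bar> =
      \<bar>sum f ?B - sum g ?B\<bar> / card (boards n)"
    by (simp flip: diff_divide_distrib)
  ultimately show ?thesis
    unfolding sumf sumg board_prob_no_crossing[OF assms(1,2)] by simp
qed

section \<open>The limit over odd sizes\<close>

lemma sum_Sol_tendsto:
  fixes F :: "nat \<Rightarrow> real"
  assumes F: "\<And>n k. n \<ge> 1 \<Longrightarrow> k \<le> n ^ 4 \<Longrightarrow> \<bar>F k\<bar> \<le> real (n ^ 4)"
  shows "(\<lambda>h. (\<Sum>A\<in>Sol (2 * h + 1). F (board_length (2 * h + 1) A)) / card (boards (2 * h + 1)))
    \<longlonglongrightarrow> F 1 / 8 + 2 * ((15 * F 2 + 49 * F 3) / 512)"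
proof -
  let ?s = "\<lambda>h. (\<Sum>A\<in>{A \<in> Sol (2 * h + 1). A (1, 1) = E}. F (board_length (2 * h + 1) A)) /
    card (boards (2 * h + 1))"
  \<comment> \<open>The error bound with the exponent \<open>h - 1\<close> rewritten as
    \<open>h\<close>, at the cost of the factor \<open>64 / 63\<close>.\<close>
  let ?e = "\<lambda>h. 2 * (2 * real h + 1) ^ 4 * ((64 / 63) * (63 / 64) ^ h)"
  have bound: "\<bar>?s h - (15 * F 2 + 49 * F 3) / 512\<bar> \<le> ?e h" if "h > 0" for h
  proof -
    have "\<bar>?s h - (15 * F 2 + 49 * F 3) / 512\<bar> \<le> 2 * real ((2 * h + 1) ^ 4) * (63 / 64) ^ (h - 1)"
      using that by (intro sum_corner_E_approx F) auto
    also have "\<dots> = ?e h"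
    proof -
      have "(63 / 64 :: real) ^ (h - 1) = 64 / 63 * (63 / 64) ^ h"
        using that by (cases h) simp_all
      moreover have "real ((2 * h + 1) ^ 4) = (2 * real h + 1) ^ 4"
        by (simp add: add.commute)
      ultimately show ?thesis
        by (simp only:)
    qed
    finally show ?thesis .
  qed
  \<comment> \<open>The geometric factor beats the polynomial.\<close>
  have "?e \<longlonglongrightarrow> 0"
    by real_asymp
  then have "(\<lambda>h. ?s h - (15 * F 2 + 49 * F 3) / 512) \<longlonglongrightarrow> 0"
    by (rule Lim_null_comparison[rotated])
      (use bound in \<open>auto intro!: eventually_sequentiallyI[of 1]\<close>)
  then have "?s \<longlonglongrightarrow> (15 * F 2 + 49 * F 3) / 512"
    by (simp add: LIM_zero_iff)
  then have "(\<lambda>h. F 1 / 8 + 2 * ?s h) \<longlonglongrightarrow> F 1 / 8 + 2 * ((15 * F 2 + 49 * F 3) / 512)"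
    by (intro tendsto_add[OF tendsto_const tendsto_mult[OF tendsto_const]])
  \<comment> \<open>The decomposition needs size at least 3, so it holds from \<open>h = 1\<close>
    on.\<close>
  then show ?thesis
    by (rule Lim_transform_eventually)
      (rule eventually_sequentiallyI[of 1], rule sum_Sol[symmetric], auto)
qed

text \<open>The expectation is \<open>?len h / ?one h\<close>, where the proportion
  \<open>?one h\<close> of solvable boards tends to \<open>3/8\<close> and \<open>?len h\<close> to
  \<open>418/512\<close>.\<close>

lemma expected_length_odd_tendsto: "(\<lambda>h. expected_length (2 * h + 1)) \<longlonglongrightarrow> 209 / 96"
proof -
  let ?len = "\<lambda>h. (\<Sum>A\<in>Sol (2 * h + 1). real (board_length (2 * h + 1) A)) /
    card (boards (2 * h + 1))"
  let ?one = "\<lambda>h. (\<Sum>A\<in>Sol (2 * h + 1). 1 :: real) / card (boards (2 * h + 1))"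
  have "?len \<longlonglongrightarrow> real 1 / 8 + 2 * ((15 * real 2 + 49 * real 3) / 512)"
    by (rule sum_Sol_tendsto[where F = real]) (simp only: abs_of_nat of_nat_le_iff)
  moreover have "?one \<longlonglongrightarrow> 1 / 8 + 2 * ((15 * 1 + 49 * 1) / 512)"
    by (rule sum_Sol_tendsto[where F = "\<lambda>_. 1"]) (simp add: one_le_power)
  ultimately have "(\<lambda>h. ?len h / ?one h) \<longlonglongrightarrow>
      (real 1 / 8 + 2 * ((15 * real 2 + 49 * real 3) / 512)) / (1 / 8 + 2 * ((15 * 1 + 49 * 1) / 512))"
    by (rule tendsto_divide) simp
  then have "(\<lambda>h. ?len h / ?one h) \<longlonglongrightarrow> 209 / 96"
    by simp
  moreover have "\<forall>\<^sub>F h in sequentially. ?len h / ?one h = expected_length (2 * h + 1)"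
  proof (rule eventually_sequentiallyI)
    fix h :: nat assume "1 \<le> h"
    then show "?len h / ?one h = expected_length (2 * h + 1)"
      using card_boards_pos[of "2 * h + 1"] Sol_nonempty[of "2 * h + 1"]
      by (simp add: expected_length_def integral_pmf_of_set finite_Sol)
  qed
  ultimately show ?thesis
    by (rule Lim_transform_eventually)
qed

theorem theorem3p3:
  shows "(expected_length \<longlongrightarrow> 209 / 96) (inf at_top (principal {n. odd n \<and> n \<ge> 3}))"
proof -
  let ?G = "inf at_top (principal {n :: nat. odd n \<and> n \<ge> 3})"
  \<comment> \<open>Every odd \<open>n\<close> equals \<open>2 * (n div 2) + 1\<close>, so composing
    with \<open>n div 2\<close> turns the limit in \<open>h\<close> into one in
    \<open>n\<close>.\<close>
  have "filterlim (\<lambda>n :: nat. n div 2) at_top at_top"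
    by (rule filterlim_at_top_div_const_nat) simp
  then have "((\<lambda>n. expected_length (2 * (n div 2) + 1)) \<longlongrightarrow> 209 / 96) at_top"
    by (rule filterlim_compose[OF expected_length_odd_tendsto])
  then have "((\<lambda>n. expected_length (2 * (n div 2) + 1)) \<longlongrightarrow> 209 / 96) ?G"
    by (rule tendsto_mono[rotated]) simp
  moreover have "\<forall>\<^sub>F n in ?G. expected_length (2 * (n div 2) + 1) = expected_length n"
    by (auto simp: eventually_inf_principal)
  ultimately show ?thesis
    by (rule Lim_transform_eventually)
qed

end
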